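(* Let $q_0$ be a rational number such that neither $2+q_0$ nor $2-q_0$ is a rational square. Then for every $k=1,2,\dots$ and $s=0,1,2,\dots$, $Z_k\cap\{p: 2^{k+s}\,\|\,\widehat p\}\subset\Pi_{s+2}(q_0)$.
   Context: Chebyshev polynomials: $U_0=0$, $U_1=1$, $U_{n+1}=qU_n-U_{n-1}$; $C_n=U_{n+1}-U_{n-1}$. For a rational $q$ and an odd prime $p$ not dividing the denominator of $q$ (congruences in $\mathbb F_p$): $p\in\Pi_{2+k}(q)$ ($k\ge0$) if $C_{2^kn}(q)\equiv0\bmod p$ for some odd $n\ge1$. Legendre symbol of a rational $x=a/b$ (lowest terms) at an odd prime $p\nmid b$: $(x|p)=1$ if $ab$ is a nonzero square mod $p$, $-1$ if a nonsquare, $0$ if $p\mid a$. Let $\delta=q_0^2-4$, let $\Pi'$ be the set of odd primes dividing neither the numerator nor the denominator of $\delta$, and for $p\in\Pi'$ put $\widehat p=\frac{p-(\delta|p)}{2}$. For $s\ge1$, $\Omega_s^{\pm}=\{p\in\Pi': C_{2^s}(a)\equiv\pm q_0 \bmod p \text{ for some } a\in\mathbb F_p\}$, and $\Omega_0^\pm=\Pi'$. $R_k=\Omega_k^+\cap\Omega_k^-$, $Z_k=R_{k-1}\setminus(\Omega_k^+\cup\Omega_k^-)$. $2^j\,\|\,m$ means $2^j\mid m$ and $2^{j+1}\nmid m$. *)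

theory Defs
  imports
    "HOL-Computational_Algebra.Computational_Algebra"
    "HOL-Number_Theory.Number_Theory"
begin

fun cheb_U :: "nat \<Rightarrow> 'a :: comm_ring_1 poly" where
  "cheb_U 0 = 0"
| "cheb_U (Suc 0) = 1"
| "cheb_U (Suc (Suc n)) = [:0, 1:] * cheb_U (Suc n) - cheb_U n"

text \<open>The value 2 at index 0 is the one obtained by extending the recursion of U to the index -1.\<close>

fun cheb_C :: "nat \<Rightarrow> 'a :: comm_ring_1 poly" where
  "cheb_C 0 = 2"
| "cheb_C (Suc n) = cheb_U (Suc (Suc n)) - cheb_U n"

definition rat_num :: "rat \<Rightarrow> int" where
  "rat_num x = fst (quotient_of x)"

definition rat_den :: "rat \<Rightarrow> int" where
  "rat_den x = snd (quotient_of x)"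

text \<open>Equality of the images of two rationals in the field with \<open>p\<close> elements (\<open>p\<close> prime);
  it includes the requirement that both images exist.\<close>

definition rat_cong :: "nat \<Rightarrow> rat \<Rightarrow> rat \<Rightarrow> bool" where
  "rat_cong p x y \<longleftrightarrow>
     \<not> int p dvd rat_den x \<and> \<not> int p dvd rat_den y \<and> int p dvd rat_num (x - y)"

text \<open>Only meaningful for odd primes \<open>p\<close> not dividing the denominator of \<open>x\<close>.\<close>

definition rat_Legendre :: "rat \<Rightarrow> nat \<Rightarrow> int" where
  "rat_Legendre x p = Legendre (rat_num x * rat_den x) (int p)"

text \<open>The index is shifted: \<open>Pi_2_plus k q\<close> is the class with index \<open>2 + k\<close>.\<close>

definition Pi_2_plus :: "nat \<Rightarrow> rat \<Rightarrow> nat set" where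
  "Pi_2_plus k q = {p. prime p \<and> odd p \<and> \<not> int p dvd rat_den q \<and>
     (\<exists>n\<ge>1. odd n \<and> rat_cong p (poly (cheb_C (2 ^ k * n)) q) 0)}"

definition delta :: "rat \<Rightarrow> rat" where
  "delta q0 = q0 ^ 2 - 4"

definition Pi' :: "rat \<Rightarrow> nat set" where
  "Pi' q0 = {p. prime p \<and> odd p \<and>
     \<not> int p dvd rat_num (delta q0) \<and> \<not> int p dvd rat_den (delta q0)}"

text \<open>For \<open>p\<close> in \<open>Pi' q0\<close> the Legendre symbol is 1 or -1 and the division is exact.\<close>

definition p_hat :: "rat \<Rightarrow> nat \<Rightarrow> int" where
  "p_hat q0 p = (int p - rat_Legendre (delta q0) p) div 2"

text \<open>Elements of the field with \<open>p\<close> elements are represented by integers.\<close>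

definition Omega_plus :: "rat \<Rightarrow> nat \<Rightarrow> nat set" where
  "Omega_plus q0 s = (if s = 0 then Pi' q0 else
     {p \<in> Pi' q0. \<exists>a :: int. rat_cong p (of_int (poly (cheb_C (2 ^ s)) a)) q0})"

definition Omega_minus :: "rat \<Rightarrow> nat \<Rightarrow> nat set" where
  "Omega_minus q0 s = (if s = 0 then Pi' q0 else
     {p \<in> Pi' q0. \<exists>a :: int. rat_cong p (of_int (poly (cheb_C (2 ^ s)) a)) (- q0)})"

definition R_set :: "rat \<Rightarrow> nat \<Rightarrow> nat set" where
  "R_set q0 k = Omega_plus q0 k \<inter> Omega_minus q0 k"

text \<open>Only meaningful for \<open>k \<ge> 1\<close>.\<close>

definition Z_set :: "rat \<Rightarrow> nat \<Rightarrow> nat set" where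
  "Z_set q0 k = R_set q0 (k - 1) - (Omega_plus q0 k \<union> Omega_minus q0 k)"

definition exact_pow2_dvd :: "nat \<Rightarrow> int \<Rightarrow> bool" where
  "exact_pow2_dvd j m \<longleftrightarrow> 2 ^ j dvd m \<and> \<not> 2 ^ (j + 1) dvd m"

end

theory Submission
  imports Defs
begin

text \<open>Let \<open>\<epsilon>\<close> be the Legendre symbol of \<open>\<delta>\<close> at \<open>p\<close>, and write the image of \<open>q0\<close> modulo \<open>p\<close> as
  \<open>C\<^bsub>2^(k-1)\<^esub>(a)\<close>. Since \<open>p\<close> is not in \<open>\<Omega>\<^sub>k\<^sup>+\<close>, \<open>a + 2\<close> is a nonresidue: if \<open>a = b\<^sup>2 - 2\<close>, then
  the image of \<open>q0\<close> would be \<open>C\<^bsub>2^k\<^esub>(b)\<close>. An analogue of Euler's criterion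
  then gives \<open>C\<^sub>n(a) \<equiv> -2\<close> modulo \<open>p\<close> for \<open>n = (p - \<epsilon>) / 2 = 2^(k+s) m\<close> with \<open>m\<close> odd. In terms
  of \<open>q0\<close> this says \<open>C\<^bsub>2^(s+1) m\<^esub>(q0) \<equiv> -2\<close>, and \<open>C\<^bsub>2n\<^esub> = C\<^sub>n\<^sup>2 - 2\<close> gives \<open>C\<^bsub>2^s m\<^esub>(q0) \<equiv> 0\<close>.\<close>

subsection \<open>Chebyshev polynomials\<close>

text \<open>The value 2 at index 0 is what makes this true already for \<open>n = 0\<close>, where
  \<open>C_2 = q^2 - 2\<close>.\<close>

lemma cheb_C_Suc_Suc:
  "cheb_C (Suc (Suc n)) = [:0, 1:] * cheb_C (Suc n) - (cheb_C n :: 'a :: comm_ring_1 poly)"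
  by (cases n) (simp_all add: algebra_simps numeral_poly one_pCons)

text \<open>As \<open>u * v = 1\<close>, both sides satisfy the same second-order recursion, and
  they agree at 0 and 1.\<close>

lemma poly_cheb_C_sum_inverse:
  fixes u v :: "'a :: comm_ring_1"
  assumes "u * v = 1"
  shows "poly (cheb_C n) (u + v) = u ^ n + v ^ n"
proof (induction n rule: cheb_U.induct)
  case (3 n)
  have uv: "u * (v * x) = x" "v * (u * x) = x" for x
    using assms by (metis mult.assoc mult.commute mult_1)+
  from 3 show ?case
    by (simp add: cheb_C_Suc_Suc algebra_simps uv del: cheb_C.simps)
qed (simp_all add: algebra_simps)

text \<open>Binet's formula, multiplied by \<open>u - v\<close> rather than divided, so that it
  holds in every commutative ring and also for \<open>u = v\<close>.\<close>

lemma poly_cheb_U_sum_inverse: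
  fixes u v :: "'a :: comm_ring_1"
  assumes "u * v = 1"
  shows "(u - v) * poly (cheb_U n) (u + v) = u ^ n - v ^ n"
proof (induction n rule: cheb_U.induct)
  case (3 n)
  have uv: "u * (v * x) = x" "v * (u * x) = x" for x
    using assms by (metis mult.assoc mult.commute mult_1)+
  have "(u - v) * poly (cheb_U (Suc (Suc n))) (u + v) =
    (u + v) * ((u - v) * poly (cheb_U (Suc n)) (u + v)) - (u - v) * poly (cheb_U n) (u + v)"
    by (simp add: algebra_simps)
  also have "\<dots> = u ^ Suc (Suc n) - v ^ Suc (Suc n)"
    unfolding 3 by (simp add: algebra_simps uv)
  finally show ?case .
qed simp_all

lemma poly_cheb_U_of_int:
  "poly (cheb_U n) (of_int a :: 'a :: comm_ring_1) = of_int (poly (cheb_U n) a)"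
  by (induction n rule: cheb_U.induct) simp_all

lemma poly_cheb_C_of_int:
  "poly (cheb_C n) (of_int a :: 'a :: comm_ring_1) = of_int (poly (cheb_C n) a)"
  by (cases n) (simp_all add: poly_cheb_U_of_int)

text \<open>The roots of \<open>X^2 - x X + 1\<close>. They allow integer identities to be checked
  over the complex numbers, into which the integers embed.\<close>

lemma complex_sum_inverse:
  obtains u v :: complex where "u * v = 1" "x = u + v"
proof
  show "(x + csqrt (x\<^sup>2 - 4)) / 2 * ((x - csqrt (x\<^sup>2 - 4)) / 2) = 1"
    by (simp add: square_diff_square_factored[symmetric] flip: power2_eq_square)
  show "x = (x + csqrt (x\<^sup>2 - 4)) / 2 + (x - csqrt (x\<^sup>2 - 4)) / 2"
    by (simp add: field_simps)
qed

text \<open>Under \<open>a = u + v\<close> with \<open>u * v = 1\<close>, applying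
  \<open>C_n\<close> replaces \<open>u\<close>, \<open>v\<close> by their \<open>n\<close>-th
  powers, so composition multiplies indices.\<close>

lemma cheb_C_mult:
  fixes a :: int
  shows "poly (cheb_C (m * n)) a = poly (cheb_C m) (poly (cheb_C n) a)"
proof -
  obtain u v :: complex where uv: "u * v = 1" "of_int a = u + v"
    by (rule complex_sum_inverse)
  have "u ^ n * v ^ n = 1"
    using uv by (simp flip: power_mult_distrib)
  then have "(of_int (poly (cheb_C m) (poly (cheb_C n) a)) :: complex) = of_int (poly (cheb_C (m * n)) a)"
    unfolding poly_cheb_C_of_int[symmetric] uv(2) poly_cheb_C_sum_inverse[OF uv(1)]
    by (simp add: poly_cheb_C_sum_inverse power_mult mult.commute[of m])
  then show ?thesis by simp
qed

lemma cheb_C_2: "poly (cheb_C 2) (a :: int) = a\<^sup>2 - 2"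
  by (simp add: numeral_2_eq_2 algebra_simps)

lemma cheb_C_double: "poly (cheb_C (2 * n)) (a :: int) = (poly (cheb_C n) a)\<^sup>2 - 2"
  by (simp only: cheb_C_mult cheb_C_2)

text \<open>If \<open>x * y = 1\<close>, then \<open>(x + y)^2 - 4 = (x - y)^2\<close>; this is used
  for \<open>u\<close>, \<open>v\<close> and for their \<open>n\<close>-th powers. The identity
  later shows that \<open>a^2 - 4\<close> and \<delta> have the same quadratic character.\<close>

lemma cheb_Pell:
  fixes a :: int
  shows "(poly (cheb_C n) a)\<^sup>2 - 4 = (a\<^sup>2 - 4) * (poly (cheb_U n) a)\<^sup>2"
proof -
  obtain u v :: complex where uv: "u * v = 1" "of_int a = u + v"
    by (rule complex_sum_inverse)
  have uvn: "u ^ n * v ^ n = 1"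
    using uv by (simp flip: power_mult_distrib)
  have disc: "(x + y)\<^sup>2 - 4 = (x - y)\<^sup>2" if "x * y = 1" for x y :: complex
    using that by (simp add: power2_eq_square algebra_simps)
  have "(of_int ((a\<^sup>2 - 4) * (poly (cheb_U n) a)\<^sup>2) :: complex) =
      ((u - v) * poly (cheb_U n) (u + v))\<^sup>2"
    using disc[OF uv(1)] by (simp add: poly_cheb_U_of_int[symmetric] uv(2) power_mult_distrib)
  also have "\<dots> = (u ^ n + v ^ n)\<^sup>2 - 4"
    unfolding poly_cheb_U_sum_inverse[OF uv(1)] disc[OF uvn] ..
  also have "\<dots> = of_int ((poly (cheb_C n) a)\<^sup>2 - 4)"
    by (simp add: poly_cheb_C_of_int[symmetric] uv(2) poly_cheb_C_sum_inverse[OF uv(1)])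
  finally show ?thesis by (simp only: of_int_eq_iff)
qed

subsection \<open>An analogue of Euler's criterion\<close>

text \<open>In the binomial expansion the terms with even \<open>k\<close> cancel, and those with
  odd \<open>k < p\<close> are divisible by \<open>p\<close>. The extra factor \<open>b\<close>
  leaves only even powers of \<open>b\<close> and \<open>c\<close>, hence integers.\<close>

lemma prime_binomial_half_sum:
  fixes b c :: complex and m l :: int
  assumes p: "prime p" "odd p" and b: "b\<^sup>2 = of_int m" and c: "c\<^sup>2 = of_int l"
  shows "\<exists>t. b * ((b + c) ^ p + (b - c) ^ p) = of_int (2 * m ^ ((p + 1) div 2) + int p * t)"
proof -
  define f where "f k = b * (of_nat (p choose k) * b ^ k * (c ^ (p - k) + (- c) ^ (p - k)))" for k
  have "\<exists>t. f k = of_int (int p * t)" if "k < p" for k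
  proof (cases "even k")
    case True
    then have "f k = 0"
      using that p by (simp add: f_def)
    then show ?thesis by (intro exI[of _ 0]) simp
  next
    case False
    then have "0 < k" by (auto intro: Nat.gr0I)
    with that p have "p dvd p choose k"
      by (intro dvd_choose_prime) auto
    then obtain d where d: "p choose k = p * d" ..
    obtain j where j: "k = 2 * j + 1" using False by (auto elim: oddE)
    have "even (p - k)" using False p that by simp
    then obtain i where i: "p - k = 2 * i" by (rule evenE)
    have "b * b ^ k = of_int (m ^ (j + 1))"
      by (simp add: j power_mult b flip: power2_eq_square mult.assoc)
    moreover have "c ^ (p - k) + (- c) ^ (p - k) = of_int (2 * l ^ i)"
      by (simp add: i power_mult c)
    moreover have "f k = of_nat (p choose k) * (b * b ^ k) * (c ^ (p - k) + (- c) ^ (p - k))"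
      by (simp add: f_def)
    ultimately have "f k = of_int (int p * (int d * m ^ (j + 1) * (2 * l ^ i)))"
      by (simp add: d)
    then show ?thesis by blast
  qed
  then obtain g where g: "\<And>k. k < p \<Longrightarrow> f k = of_int (int p * g k)"
    by metis
  have "b * ((b + c) ^ p + (b + - c) ^ p) = (\<Sum>k\<le>p. f k)"
    unfolding binomial_ring f_def
    by (simp add: sum_distrib_left ring_distribs flip: sum.distrib)
  also have "\<dots> = (\<Sum>k<p. f k) + f p"
    by (simp flip: lessThan_Suc_atMost)
  also have "(\<Sum>k<p. f k) = of_int (int p * (\<Sum>k<p. g k))"
    by (simp add: g sum_distrib_left)
  \<comment> \<open>For \<open>k = p\<close> both powers of \<open>c\<close> and \<open>- c\<close>
    have exponent 0 and add up to 2, so \<open>f p = 2 * b^(p+1)\<close>.\<close>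
  also have "f p = of_int (2 * m ^ ((p + 1) div 2))"
  proof -
    obtain h where "p = 2 * h + 1" using p by (auto elim: oddE)
    then show ?thesis
      by (simp add: f_def power_mult b flip: power2_eq_square mult.assoc)
  qed
  finally show ?thesis
    by (intro exI[of _ "\<Sum>k<p. g k"]) (simp add: add.commute)
qed

text \<open>With \<open>z = (b + c) / 2\<close> and \<open>w = (b - c) / 2\<close>, where \<open>b\<^sup>2 = a + 2\<close> and \<open>c\<^sup>2 = a - 2\<close>, one has
  \<open>z w = 1\<close> and \<open>C\<^sub>n(a) = z\<^bsup>2n\<^esup> + w\<^bsup>2n\<^esup>\<close>. Modulo \<open>p\<close>, the \<open>p\<close>-th power multiplies \<open>b\<close> and \<open>c\<close> by the
  quadratic characters of \<open>a + 2\<close> and \<open>a - 2\<close>, that is, by \<open>-1\<close> and \<open>-e\<close>, so it sends \<open>z\<close> to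
  \<open>-z\<^bsup>e\<^esup>\<close>. The previous lemma allows one to say this with integers only.\<close>

lemma cheb_C_nonresidue:
  fixes a :: int and e :: int
  assumes p: "prime p" "odd p" and e: "e = 1 \<or> e = -1"
    and nr: "[(a + 2) ^ ((p - 1) div 2) = -1] (mod int p)"
    and eul: "[(a\<^sup>2 - 4) ^ ((p - 1) div 2) = e] (mod int p)"
    and N: "2 * int N = int p - e"
  shows "[poly (cheb_C N) a = -2] (mod int p)"
proof -
  define h where "h = (p - 1) div 2"
  have ph: "p = 2 * h + 1" using p by (auto simp: h_def elim!: oddE)
  define m l where "m = a + 2" and "l = a - 2"
  define b c where "b = csqrt (of_int m)" and "c = csqrt (of_int l)"
  have b: "b\<^sup>2 = of_int m" and c: "c\<^sup>2 = of_int l" by (simp_all add: b_def c_def)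
  obtain t where t: "b * ((b + c) ^ p + (b - c) ^ p) = of_int (2 * m ^ (h + 1) + int p * t)"
    using prime_binomial_half_sum[OF p b c] ph by auto
  obtain t' where t': "c * ((c + b) ^ p + (c - b) ^ p) = of_int (2 * l ^ (h + 1) + int p * t')"
    using prime_binomial_half_sum[OF p c b] ph by auto
  have t'': "c * ((b + c) ^ p - (b - c) ^ p) = of_int (2 * l ^ (h + 1) + int p * t')"
    using t' p power_minus_odd[of p "b - c"] by (simp add: add.commute)
  define z w where "z = (b + c) / 2" and "w = (b - c) / 2"
  have zw: "z * w = 1"
    using b c by (simp add: z_def w_def m_def l_def algebra_simps power2_eq_square)
  have bc: "b + c = 2 * z" "b - c = 2 * w" "b = z + w" "c = z - w"
    by (simp_all add: z_def w_def field_simps)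
  have "z\<^sup>2 + w\<^sup>2 = of_int a"
    using b c by (simp add: z_def w_def m_def l_def field_simps power2_eq_square)
  moreover have "z\<^sup>2 * w\<^sup>2 = 1" using zw by (simp flip: power_mult_distrib)
  ultimately have C: "of_int (poly (cheb_C N) a) = z ^ (2 * N) + w ^ (2 * N)"
    by (metis poly_cheb_C_of_int poly_cheb_C_sum_inverse power_mult)
  \<comment> \<open>For \<open>e = 1\<close> the pure powers cancel and the mixed terms
    \<open>w * z^p\<close>, \<open>z * w^p\<close> drop to exponent \<open>p - 1\<close> by
    \<open>z * w = 1\<close>; for \<open>e = -1\<close> the mixed terms cancel.\<close>
  have step: "(z + w) * (z ^ p + w ^ p) - of_int e * ((z - w) * (z ^ p - w ^ p))
      = 2 * (z ^ (2 * N) + w ^ (2 * N))"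
    using e
  proof
    assume "e = 1"
    then have "p = Suc (2 * N)" using N by linarith
    moreover have zwx: "z * (w * x) = x" "w * (z * x) = x" for x
      using zw by (metis mult.assoc mult.commute mult_1)+
    ultimately show ?thesis using \<open>e = 1\<close>
      by (simp add: distrib_left distrib_right right_diff_distrib left_diff_distrib zwx)
  next
    assume "e = -1"
    then have "2 * N = Suc p" using N by linarith
    then show ?thesis using \<open>e = -1\<close>
      by (simp add: algebra_simps)
  qed
  \<comment> \<open>The factor \<open>2^p\<close> clears the denominators of \<open>z^p\<close> and
    \<open>w^p\<close>.\<close>
  have "of_int (2 ^ p * 2 * poly (cheb_C N) a) = 
      2 ^ p * ((z + w) * (z ^ p + w ^ p) - of_int e * ((z - w) * (z ^ p - w ^ p)))"
    unfolding step by (simp add: C)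
  also have "\<dots> = b * ((b + c) ^ p + (b - c) ^ p) - of_int e * (c * ((b + c) ^ p - (b - c) ^ p))"
    unfolding bc(1,2) power_mult_distrib unfolding bc(3,4) by (simp add: algebra_simps)
  also have "\<dots> = of_int (2 * m ^ (h + 1) + int p * t - e * (2 * l ^ (h + 1) + int p * t'))"
    unfolding t t'' by simp
  finally have eq: "2 ^ p * 2 * poly (cheb_C N) a =
      2 * m ^ (h + 1) + int p * t - e * (2 * l ^ (h + 1) + int p * t')"
    by (simp only: of_int_eq_iff)
  have ee: "e * e = 1" using e by auto
  have m1: "[m ^ h = -1] (mod int p)" using nr by (simp add: m_def h_def)
  have "a\<^sup>2 - 4 = m * l" by (simp add: m_def l_def algebra_simps power2_eq_square)
  then have "[m ^ h * l ^ h = e] (mod int p)"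
    using eul by (simp add: h_def power_mult_distrib)
  moreover have "[m ^ h * l ^ h = -1 * l ^ h] (mod int p)"
    using m1 by (rule cong_scalar_right)
  ultimately have "[-1 * l ^ h = e] (mod int p)"
    by (meson cong_sym cong_trans)
  then have l1: "[e * l ^ h = -1] (mod int p)"
    using cong_scalar_left[of "-1 * l ^ h" e "int p" "-e"] ee by simp
  have "[2 ^ p = (2 :: int)] (mod int p)"
  proof -
    have "\<not> p dvd 2" using p primes_dvd_imp_eq[of p 2] by auto
    then have "[2 ^ (p - 1) = 1] (mod p)" using fermat_theorem p by blast
    then have "[2 * 2 ^ (p - 1) = 2 * 1] (mod p)" by (rule cong_scalar_left)
    moreover have "2 * 2 ^ (p - 1) = (2 :: nat) ^ p" by (simp add: ph)
    ultimately have "[int (2 ^ p) = int 2] (mod int p)"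
      by (simp only: cong_int_iff mult_1_right)
    then show ?thesis by simp
  qed
  then have "[2 ^ p * 2 * poly (cheb_C N) a = 2 * 2 * poly (cheb_C N) a] (mod int p)"
    by (intro cong_mult cong_refl)
  \<comment> \<open>Since \<open>m - l = 4\<close>, the right-hand side is -8.\<close>
  moreover have "[2 ^ p * 2 * poly (cheb_C N) a = 2 * (m * -1) - 2 * (l * -1)] (mod int p)"
  proof -
    have "[2 * (m * m ^ h) - 2 * (l * (e * l ^ h)) = 2 * (m * -1) - 2 * (l * -1)] (mod int p)"
      using m1 l1 by (intro cong_diff cong_mult cong_refl)
    moreover have "2 ^ p * 2 * poly (cheb_C N) a =
        2 * (m * m ^ h) - 2 * (l * (e * l ^ h)) + int p * (t - e * t')"
      unfolding eq by (simp add: algebra_simps)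
    ultimately show ?thesis
      by (simp add: cong_def)
  qed
  ultimately have "[4 * poly (cheb_C N) a = 4 * (-2)] (mod int p)"
    by (simp add: m_def l_def cong_def)
  moreover have "coprime 4 (int p)"
    using p coprime_power_left_iff[of 2 2 "int p"] by simp
  ultimately show ?thesis
    using cong_mult_lcancel by blast
qed

subsection \<open>Reduction of rationals modulo a prime\<close>

text \<open>The rational \<open>x\<close> lies in the localization of the integers at
  \<open>p\<close> and has residue \<open>r\<close>. Fractions need not be in lowest terms, so sums
  and products require no cancellation.\<close>

definition rat_reduces :: "nat \<Rightarrow> rat \<Rightarrow> int \<Rightarrow> bool" where
  "rat_reduces p x r \<longleftrightarrow>
     (\<exists>n d. x = of_int n / of_int d \<and> \<not> int p dvd d \<and> [n = r * d] (mod int p))"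

lemma rat_num_den:
  "x = of_int (rat_num x) / of_int (rat_den x)" "rat_den x > 0"
  "coprime (rat_num x) (rat_den x)"
  unfolding rat_num_def rat_den_def
  by (rule quotient_of_div quotient_of_denom_pos' quotient_of_coprime prod.collapse[symmetric])+

lemma rat_num_den_fraction:
  assumes "x = of_int n / of_int d" "d \<noteq> 0"
  shows "rat_num x * d = n * rat_den x"
proof -
  have "(of_int n :: rat) / of_int d = of_int (rat_num x) / of_int (rat_den x)"
    using assms rat_num_den(1) by simp
  then have "(of_int (rat_num x * d) :: rat) = of_int (n * rat_den x)"
    using assms(2) rat_num_den(2)[of x] by (simp add: field_simps)
  then show ?thesis by (simp only: of_int_eq_iff)
qed

text \<open>Cross-multiplication compares the two fractions: a \<open>p\<close> in the reduced
  denominator would also divide the reduced numerator, against coprimality.\<close>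

lemma rat_reduces_iff:
  assumes "prime p"
  shows "rat_reduces p x r \<longleftrightarrow>
    \<not> int p dvd rat_den x \<and> [rat_num x = r * rat_den x] (mod int p)"
proof
  assume "rat_reduces p x r"
  then obtain n d where nd: "x = of_int n / of_int d" "\<not> int p dvd d" "[n = r * d] (mod int p)"
    by (auto simp: rat_reduces_def)
  from nd(2) have eq: "rat_num x * d = n * rat_den x"
    by (intro rat_num_den_fraction nd(1)) auto
  have pp: "prime (int p)" using assms by simp
  have "\<not> int p dvd rat_den x"
  proof
    assume *: "int p dvd rat_den x"
    then have "int p dvd rat_num x * d" by (simp add: eq)
    then have "int p dvd rat_num x" using nd(2) pp by (simp add: prime_dvd_mult_iff)
    with * rat_num_den(3)[of x] pp show False
      by (meson coprime_common_divisor not_prime_unit)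
  qed
  moreover have "[rat_num x * d = r * rat_den x * d] (mod int p)"
    unfolding eq using cong_scalar_right[OF nd(3), of "rat_den x"] by (simp add: mult_ac)
  moreover have "coprime d (int p)"
    using nd(2) pp prime_imp_coprime[of "int p"] by (simp add: coprime_commute)
  ultimately show "\<not> int p dvd rat_den x \<and> [rat_num x = r * rat_den x] (mod int p)"
    by (simp add: cong_mult_rcancel)
next
  assume "\<not> int p dvd rat_den x \<and> [rat_num x = r * rat_den x] (mod int p)"
  then show "rat_reduces p x r"
    using rat_num_den(1) by (auto simp: rat_reduces_def)
qed

lemma rat_reduces_of_int:
  assumes "prime p"
  shows "rat_reduces p (of_int a) a"
  unfolding rat_reduces_def using assms prime_gt_1_nat[of p]
  by (intro exI[of _ a] exI[of _ 1]) simp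

lemma rat_reduces_diff:
  assumes "prime p" "rat_reduces p x r" "rat_reduces p y t"
  shows "rat_reduces p (x - y) (r - t)"
proof -
  obtain n d where nd: "x = of_int n / of_int d" "\<not> int p dvd d" "[n = r * d] (mod int p)"
    using assms by (auto simp: rat_reduces_def)
  obtain m l where ml: "y = of_int m / of_int l" "\<not> int p dvd l" "[m = t * l] (mod int p)"
    using assms by (auto simp: rat_reduces_def)
  have "d \<noteq> 0" "l \<noteq> 0" using nd ml by auto
  then have "x - y = of_int (n * l - m * d) / of_int (d * l)"
    by (simp add: nd ml field_simps)
  moreover have "\<not> int p dvd d * l"
    using assms(1) nd ml by (simp add: prime_dvd_mult_iff)
  moreover have "[n * l - m * d = (r * d) * l - (t * l) * d] (mod int p)"
    using nd ml by (intro cong_diff cong_mult cong_refl)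
  then have "[n * l - m * d = (r - t) * (d * l)] (mod int p)"
    by (simp add: algebra_simps)
  ultimately show ?thesis unfolding rat_reduces_def by blast
qed

lemma rat_reduces_mult:
  assumes "prime p" "rat_reduces p x r" "rat_reduces p y t"
  shows "rat_reduces p (x * y) (r * t)"
proof -
  obtain n d where nd: "x = of_int n / of_int d" "\<not> int p dvd d" "[n = r * d] (mod int p)"
    using assms by (auto simp: rat_reduces_def)
  obtain m l where ml: "y = of_int m / of_int l" "\<not> int p dvd l" "[m = t * l] (mod int p)"
    using assms by (auto simp: rat_reduces_def)
  have "x * y = of_int (n * m) / of_int (d * l)"
    by (simp add: nd ml)
  moreover have "\<not> int p dvd d * l"
    using assms(1) nd ml by (simp add: prime_dvd_mult_iff)
  moreover have "[n * m = (r * d) * (t * l)] (mod int p)"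
    using nd ml by (intro cong_mult)
  then have "[n * m = (r * t) * (d * l)] (mod int p)"
    by (simp add: algebra_simps)
  ultimately show ?thesis unfolding rat_reduces_def by blast
qed

lemma rat_reduces_cheb_U:
  assumes "prime p" "rat_reduces p x r"
  shows "rat_reduces p (poly (cheb_U n) x) (poly (cheb_U n) r)"
proof (induction n rule: cheb_U.induct)
  case (3 n)
  then show ?case
    using assms by (simp add: rat_reduces_diff rat_reduces_mult)
qed (use rat_reduces_of_int[OF assms(1), of 0] rat_reduces_of_int[OF assms(1), of 1] in simp_all)

lemma rat_reduces_cheb_C:
  assumes "prime p" "rat_reduces p x r"
  shows "rat_reduces p (poly (cheb_C n) x) (poly (cheb_C n) r)"
proof (cases n)
  case 0
  then show ?thesis using rat_reduces_of_int[OF assms(1), of 2] by simp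
next
  case (Suc n')
  then show ?thesis
    using assms by (simp add: rat_reduces_diff rat_reduces_cheb_U del: cheb_U.simps)
qed

lemma rat_reduces_cong:
  assumes "rat_reduces p x r" "[r = t] (mod int p)"
  shows "rat_reduces p x t"
  using assms unfolding rat_reduces_def by (blast intro: cong_scalar_right cong_trans)

lemma rat_cong_of_int_iff:
  assumes "prime p"
  shows "rat_cong p x (of_int r) \<longleftrightarrow> rat_reduces p x r"
proof
  assume *: "rat_cong p x (of_int r)"
  have d: "\<not> int p dvd rat_den x"
    using * by (simp add: rat_cong_def)
  have "x - of_int r = of_int (rat_num x - r * rat_den x) / of_int (rat_den x)"
    using rat_num_den(2)[of x] by (subst rat_num_den(1)[of x]) (simp add: field_simps)
  then have "rat_num (x - of_int r) * rat_den x =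
      (rat_num x - r * rat_den x) * rat_den (x - of_int r)"
    by (rule rat_num_den_fraction) (use rat_num_den(2)[of x] in simp)
  moreover have num: "int p dvd rat_num (x - of_int r)"
    using * by (simp add: rat_cong_def)
  ultimately have "int p dvd (rat_num x - r * rat_den x) * rat_den (x - of_int r)"
    by (metis dvd_mult2)
  moreover have "\<not> int p dvd rat_den (x - of_int r)"
    using num rat_num_den(3)[of "x - of_int r"] assms
    by (meson coprime_common_divisor not_prime_unit prime_nat_int_transfer)
  ultimately have "int p dvd rat_num x - r * rat_den x"
    using assms by (simp add: prime_dvd_mult_iff)
  with d show "rat_reduces p x r"
    by (simp add: rat_reduces_iff[OF assms] cong_iff_dvd_diff)
next
  assume x: "rat_reduces p x r"
  note r = rat_reduces_of_int[OF assms, of r]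
  have "rat_reduces p (x - of_int r) 0"
    using rat_reduces_diff[OF assms x r] by simp
  with x r show "rat_cong p x (of_int r)"
    by (simp add: rat_reduces_iff[OF assms] rat_cong_def cong_0_iff)
qed

lemma rat_cong_sym: "rat_cong p x y \<Longrightarrow> rat_cong p y x"
proof -
  have "rat_num (y - x) = - rat_num (x - y)"
    using rat_uminus_code[of "x - y"] by (simp add: rat_num_def split: prod.splits)
  then show "rat_cong p x y \<Longrightarrow> rat_cong p y x"
    by (simp add: rat_cong_def)
qed

lemma rat_reduces_exists:
  assumes "prime p" "\<not> int p dvd rat_den x"
  shows "\<exists>r. rat_reduces p x r"
proof -
  have "coprime (rat_den x) (int p)"
    using assms prime_imp_coprime[of "int p"] by (simp add: coprime_commute)
  then obtain i where "[rat_den x * i = 1] (mod int p)"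
    using cong_solve_coprime_int by blast
  then have "[rat_num x * (rat_den x * i) = rat_num x * 1] (mod int p)"
    by (rule cong_scalar_left)
  then have "rat_reduces p x (rat_num x * i)"
    unfolding rat_reduces_iff[OF assms(1)] using assms(2) by (simp add: cong_sym mult_ac)
  then show ?thesis ..
qed

lemma rat_reduces_delta:
  assumes "prime p" "rat_reduces p q r"
  shows "rat_reduces p (delta q) (r\<^sup>2 - 4)"
proof -
  have "rat_reduces p 4 4"
    using rat_reduces_of_int[OF assms(1), of 4] by simp
  with assms show ?thesis
    by (simp add: delta_def power2_eq_square rat_reduces_diff rat_reduces_mult)
qed

text \<open>For \<open>q = n / d\<close> in lowest terms with \<open>p\<close> dividing
  \<open>d\<close>, clearing denominators in \<delta> makes \<open>p\<close> divide
  \<open>n^2 - 4 * d^2\<close>, hence \<open>n\<close>.\<close>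

lemma not_dvd_rat_den_delta:
  assumes "prime p" "\<not> int p dvd rat_den (delta q)"
  shows "\<not> int p dvd rat_den q"
proof
  assume *: "int p dvd rat_den q"
  define n d where "n = rat_num q" and "d = rat_den q"
  have d: "d > 0" and cop: "coprime n d" using rat_num_den by (simp_all add: n_def d_def)
  have "delta q = of_int (n\<^sup>2 - 4 * d\<^sup>2) / of_int (d\<^sup>2)"
    unfolding delta_def rat_num_den(1)[of q, folded n_def d_def]
    using d by (simp add: field_simps)
  then have "rat_num (delta q) * d\<^sup>2 = (n\<^sup>2 - 4 * d\<^sup>2) * rat_den (delta q)"
    by (rule rat_num_den_fraction) (use d in simp)
  moreover have pd: "int p dvd d\<^sup>2" using * by (simp add: d_def power2_eq_square)
  ultimately have "int p dvd (n\<^sup>2 - 4 * d\<^sup>2) * rat_den (delta q)"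
    by (metis dvd_mult)
  then have "int p dvd n\<^sup>2 - 4 * d\<^sup>2"
    using assms by (simp add: prime_dvd_mult_iff)
  then have "int p dvd n\<^sup>2 - 4 * d\<^sup>2 + 4 * d\<^sup>2"
    using pd by (meson dvd_add dvd_mult)
  then have "int p dvd n\<^sup>2" by simp
  then have "int p dvd n" using assms(1) by (simp add: prime_dvd_power_iff)
  with * cop assms(1) show False
    by (metis coprime_common_divisor d_def not_prime_unit prime_nat_int_transfer)
qed

text \<open>Euler's criterion turns the square factor into \<open>t^(p-1)\<close>, which is 1 modulo
  \<open>p\<close> by Fermat.\<close>

lemma Legendre_mult_square_cong:
  fixes t :: int
  assumes "prime p" "odd p" "\<not> int p dvd t" "[x = y * t\<^sup>2] (mod int p)"
  shows "[Legendre x (int p) = y ^ ((p - 1) div 2)] (mod int p)"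
proof -
  have p: "p > 2" using assms prime_gt_1_nat[of p] by (cases "p = 2") auto
  then have "[Legendre x (int p) = x ^ ((p - 1) div 2)] (mod int p)"
    using euler_criterion assms(1) by blast
  moreover have "[x ^ ((p - 1) div 2) = (y * t\<^sup>2) ^ ((p - 1) div 2)] (mod int p)"
    using assms(4) by (rule cong_pow)
  moreover have "(y * t\<^sup>2) ^ ((p - 1) div 2) = y ^ ((p - 1) div 2) * t ^ (p - 1)"
    using assms(2) by (simp add: power_mult_distrib flip: power_mult)
  moreover have "[y ^ ((p - 1) div 2) * t ^ (p - 1) = y ^ ((p - 1) div 2) * 1] (mod int p)"
  proof -
    have "\<not> p dvd nat \<bar>t\<bar>" using assms(3) by (simp flip: int_dvd_int_iff)
    then have "[nat \<bar>t\<bar> ^ (p - 1) = 1] (mod p)"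
      using fermat_theorem assms(1) by blast
    then have "[\<bar>t\<bar> ^ (p - 1) = 1] (mod int p)"
      by (simp flip: cong_int_iff)
    then show ?thesis
      using assms(2) by (intro cong_scalar_left) (simp add: power_even_abs)
  qed
  ultimately show ?thesis
    by (metis cong_trans mult_1_right)
qed

subsection \<open>The inclusion\<close>

theorem theorem14:
  fixes q0 :: rat and k s :: nat
  assumes "\<not> (\<exists>r :: rat. 2 + q0 = r ^ 2)"
    and "\<not> (\<exists>r :: rat. 2 - q0 = r ^ 2)"
    and "k \<ge> 1"
  shows "Z_set q0 k \<inter> {p. exact_pow2_dvd (k + s) (p_hat q0 p)} \<subseteq> Pi_2_plus s q0"
proof
  fix p assume "p \<in> Z_set q0 k \<inter> {p. exact_pow2_dvd (k + s) (p_hat q0 p)}"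
  then have R: "p \<in> Omega_plus q0 (k - 1)" and notin: "p \<notin> Omega_plus q0 k"
    and hat: "exact_pow2_dvd (k + s) (p_hat q0 p)"
    by (auto simp: Z_set_def R_set_def)
  have Pi': "p \<in> Pi' q0" using R by (auto simp: Omega_plus_def split: if_splits)
  then have p: "prime p" "odd p" and dn: "\<not> int p dvd rat_num (delta q0)"
    and dd: "\<not> int p dvd rat_den (delta q0)"
    by (auto simp: Pi'_def)
  have den: "\<not> int p dvd rat_den q0"
    using not_dvd_rat_den_delta[OF p(1) dd] .
  \<comment> \<open>For \<open>k = 1\<close> membership in \<Omega>_0 supplies no \<open>a\<close>;
    as \<open>C_1(a) = a\<close>, the residue of \<open>q0\<close> itself serves.\<close>
  have "\<exists>a. rat_reduces p q0 (poly (cheb_C (2 ^ (k - 1))) a)"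
  proof (cases "k = 1")
    case True
    then show ?thesis using rat_reduces_exists[OF p(1) den] by simp
  next
    case False
    then obtain a where "rat_cong p (of_int (poly (cheb_C (2 ^ (k - 1))) a)) q0"
      using R assms(3) by (auto simp: Omega_plus_def split: if_splits)
    then show ?thesis
      using rat_cong_sym rat_cong_of_int_iff[OF p(1)] by blast
  qed
  then obtain a where a: "rat_reduces p q0 (poly (cheb_C (2 ^ (k - 1))) a)" ..
  define r where "r = poly (cheb_C (2 ^ (k - 1))) a"
  define U where "U = poly (cheb_U (2 ^ (k - 1))) a"
  have red: "rat_reduces p q0 r" using a by (simp add: r_def)
  have p2: "p > 2" using p prime_gt_1_nat[of p] by (cases "p = 2") auto

  have nonres: "\<not> [a + 2 = b\<^sup>2] (mod int p)" for b
  proof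
    assume *: "[a + 2 = b\<^sup>2] (mod int p)"
    have "int p dvd a - poly (cheb_C 2) b"
      using * by (simp add: cheb_C_2 cong_iff_dvd_diff algebra_simps)
    \<comment> \<open>Viewing \<open>a\<close> as a rational lets \<open>rat_reduces_cheb_C\<close>
      show that \<open>C\<close> respects integer congruences.\<close>
    then have "rat_reduces p (of_int a) (poly (cheb_C 2) b)"
      by (intro rat_reduces_cong[OF rat_reduces_of_int[OF p(1)]]) (simp add: cong_iff_dvd_diff)
    then have "rat_reduces p (of_int r) (poly (cheb_C (2 ^ (k - 1))) (poly (cheb_C 2) b))"
      using rat_reduces_cheb_C[OF p(1), of "of_int a" _ "2 ^ (k - 1)"]
      by (simp only: poly_cheb_C_of_int r_def)
    then have "[r = poly (cheb_C (2 ^ (k - 1) * 2)) b] (mod int p)"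
      unfolding cheb_C_mult rat_reduces_iff[OF p(1)] by (simp add: rat_num_def rat_den_def)
    then have "[r = poly (cheb_C (2 ^ k)) b] (mod int p)"
      using assms(3) by (cases k) (simp_all add: mult.commute)
    then have "rat_reduces p q0 (poly (cheb_C (2 ^ k)) b)"
      using red rat_reduces_cong by blast
    then have "rat_cong p (of_int (poly (cheb_C (2 ^ k)) b)) q0"
      using rat_cong_sym rat_cong_of_int_iff[OF p(1)] by blast
    with notin Pi' assms(3) show False by (auto simp: Omega_plus_def)
  qed
  \<comment> \<open>The instance \<open>b = 0\<close> excludes the symbol 0, the general case
    excludes 1.\<close>
  have "Legendre (a + 2) (int p) = -1"
    using nonres[of 0] nonres cong_sym
    by (auto simp: Legendre_def QuadRes_def)
  then have nr: "[(a + 2) ^ ((p - 1) div 2) = -1] (mod int p)"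
    using euler_criterion[OF p(1) p2, of "a + 2"] by (simp add: cong_sym)

  define e where "e = rat_Legendre (delta q0) p"
  have e: "e = 1 \<or> e = -1"
    using dn dd p(1)
    by (auto simp: e_def rat_Legendre_def Legendre_def cong_0_iff prime_dvd_mult_iff)
  have num: "[rat_num (delta q0) = (r\<^sup>2 - 4) * rat_den (delta q0)] (mod int p)"
    using rat_reduces_delta[OF p(1) red] by (simp add: rat_reduces_iff[OF p(1)])
  have Pell: "r\<^sup>2 - 4 = (a\<^sup>2 - 4) * U\<^sup>2"
    unfolding r_def U_def by (rule cheb_Pell)
  \<comment> \<open>Otherwise \<open>p\<close> would divide the numerator of \<delta>. So \<delta>
    and \<open>a^2 - 4\<close> differ modulo \<open>p\<close> by a nonzero square factor.\<close>
  have "\<not> int p dvd U"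
  proof
    assume "int p dvd U"
    then have "int p dvd (r\<^sup>2 - 4) * rat_den (delta q0)"
      unfolding Pell by (simp add: power2_eq_square)
    then show False using cong_dvd_iff[OF num] dn by blast
  qed
  then have "\<not> int p dvd U * rat_den (delta q0)"
    using dd p(1) by (simp add: prime_dvd_mult_iff)
  moreover have "[rat_num (delta q0) * rat_den (delta q0) =
      (a\<^sup>2 - 4) * (U * rat_den (delta q0))\<^sup>2] (mod int p)"
    using cong_scalar_right[OF num[unfolded Pell], of "rat_den (delta q0)"]
    by (simp add: power2_eq_square mult_ac)
  ultimately have eul: "[(a\<^sup>2 - 4) ^ ((p - 1) div 2) = e] (mod int p)"
    unfolding e_def rat_Legendre_def
    using Legendre_mult_square_cong[OF p] cong_sym by blast

  obtain m' where m': "p_hat q0 p = 2 ^ (k + s) * m'"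
    using hat by (auto simp: exact_pow2_dvd_def)
  have "odd m'"
    using hat by (auto simp: exact_pow2_dvd_def m')
  \<comment> \<open>Both \<open>p\<close> and \<open>e\<close> are odd, so the integer division in
    \<open>p_hat\<close> is exact.\<close>
  have hat2: "2 * p_hat q0 p = int p - e"
  proof -
    have "even (int p - e)" using p(2) e by auto
    then show ?thesis by (simp add: p_hat_def e_def)
  qed
  have "p_hat q0 p > 0" using hat2 p2 e by linarith
  then have "m' > 0" by (simp add: m' zero_less_mult_iff)
  define m where "m = nat m'"
  have m: "odd m" "m \<ge> 1" "p_hat q0 p = int (2 ^ (k + s) * m)"
    using \<open>odd m'\<close> \<open>m' > 0\<close> by (simp_all add: m_def m' even_nat_iff)
  have "[poly (cheb_C (2 ^ (k + s) * m)) a = -2] (mod int p)"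
    by (rule cheb_C_nonresidue[OF p e nr eul hat2[unfolded m(3)]])
  \<comment> \<open>The factor \<open>2^(k-1)\<close> carries \<open>a\<close> to \<open>r\<close>;
    the single factor 2 is kept for the doubling formula, where -2 forces a zero square.\<close>
  moreover have "2 ^ (k + s) * m = 2 * (2 ^ s * m) * 2 ^ (k - 1)"
    using assms(3) by (cases k) (simp_all add: power_add mult_ac)
  ultimately have "[poly (cheb_C (2 * (2 ^ s * m))) r = -2] (mod int p)"
    unfolding r_def cheb_C_mult[symmetric] by metis
  then have "int p dvd (poly (cheb_C (2 ^ s * m)) r)\<^sup>2"
    unfolding cheb_C_double cong_iff_dvd_diff by simp
  then have "int p dvd poly (cheb_C (2 ^ s * m)) r"
    using p(1) by (simp add: prime_dvd_power_iff)
  then have "rat_reduces p (poly (cheb_C (2 ^ s * m)) q0) 0"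
    by (intro rat_reduces_cong[OF rat_reduces_cheb_C[OF p(1) red]]) (simp add: cong_0_iff)
  then have "rat_cong p (poly (cheb_C (2 ^ s * m)) q0) 0"
    using rat_cong_of_int_iff[OF p(1), of _ 0] by simp
  with p den m(1,2) show "p \<in> Pi_2_plus s q0"
    unfolding Pi_2_plus_def by blast
qed

end
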